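(* Let $d_1,d_2,d_3\ge 2$. The set of tensors $A\in\mathbb{R}^{d_1\times d_2\times d_3}$ that do not have a best rank-$2$ approximation in the Frobenius norm (that is, for which $\inf\{\|A-B\|_F : \operatorname{rank}_{\otimes}(B)\le 2\}$ is not attained by any $B$ with $\operatorname{rank}_\otimes(B)\le 2$) contains an open neighborhood of the set of tensors of type $G_3$. In particular, this set is nonempty and has positive volume.
   Context: $\mathbb{R}^{d_1\times d_2\times d_3}\cong\mathbb{R}^{d_1}\otimes\mathbb{R}^{d_2}\otimes\mathbb{R}^{d_3}$ is the space of real 3-way arrays; $\mathbf{x}\otimes\mathbf{y}\otimes\mathbf{z}$ is the array with entries $x_iy_jz_k$ (a decomposable tensor). The outer-product rank $\operatorname{rank}_{\otimes}(A)$ is the least $r\ge 0$ such that $A$ is a sum of $r$ decomposable tensors. The Frobenius norm is $\|A\|_F=(\sum_{i,j,k}a_{ijk}^2)^{1/2}$. Matrices act by multilinear multiplication: $(L,M,N)\cdot A$ has entries $\sum_{i,j,k}\lambda_{pi}\mu_{qj}\nu_{rk}a_{ijk}$ where $L=[\lambda_{pi}]$, $M=[\mu_{qj}]$, $N=[\nu_{rk}]$. Let $G_3\in\mathbb{R}^{2\times2\times2}$ be $$G_3=\mathbf{e}_1\otimes\mathbf{e}_1\otimes\mathbf{e}_1+\mathbf{e}_1\otimes\mathbf{e}_2\otimes\mathbf{e}_2-\mathbf{e}_2\otimes\mathbf{e}_1\otimes\mathbf{e}_2+\mathbf{e}_2\otimes\mathbf{e}_2\otimes\mathbf{e}_1 ,$$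 with $\mathbf{e}_1,\mathbf{e}_2$ the standard basis of $\mathbb{R}^2$. Regard $G_3$ as an element of $\mathbb{R}^{d_1\times d_2\times d_3}$ by padding with zeros. A tensor $A\in\mathbb{R}^{d_1\times d_2\times d_3}$ is of type $G_3$ if $A=(L,M,N)\cdot G_3$ for some $(L,M,N)\in \mathrm{GL}_{d_1}(\mathbb{R})\times \mathrm{GL}_{d_2}(\mathbb{R})\times \mathrm{GL}_{d_3}(\mathbb{R})$. Volume means Lebesgue measure. *)

theory Defs
  imports "HOL-Analysis.Analysis"
begin

text \<open>
  A tensor in the space of \<open>d\<^sub>1 \<times> d\<^sub>2 \<times> d\<^sub>3\<close> real arrays is an element \<open>A\<close> of
  \<open>real ^ 'd3 ^ 'd2 ^ 'd1\<close> with \<open>d\<^sub>i = CARD('di)\<close>; its entries are \<open>A $ i $ j $ k\<close>.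
\<close>

definition outer :: "real ^ 'd1 \<Rightarrow> real ^ 'd2 \<Rightarrow> real ^ 'd3 \<Rightarrow> real ^ 'd3 ^ 'd2 ^ 'd1" where
  "outer x y z = (\<chi> i j k. x $ i * y $ j * z $ k)"

definition outer_rank :: "real ^ 'd3 ^ 'd2 ^ 'd1 \<Rightarrow> nat" where
  "outer_rank A = (LEAST r. \<exists>x y z. A = (\<Sum>l<r. outer (x l) (y l) (z l)))"

definition frobenius_norm :: "real ^ 'd3 ^ 'd2 ^ 'd1 \<Rightarrow> real" where
  "frobenius_norm A = sqrt (\<Sum>i\<in>UNIV. \<Sum>j\<in>UNIV. \<Sum>k\<in>UNIV. (A $ i $ j $ k)\<^sup>2)"

definition multilinear_mult ::
  "real ^ 'd1 ^ 'e1 \<Rightarrow> real ^ 'd2 ^ 'e2 \<Rightarrow> real ^ 'd3 ^ 'e3 \<Rightarrow>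
   real ^ 'd3 ^ 'd2 ^ 'd1 \<Rightarrow> real ^ 'e3 ^ 'e2 ^ 'e1" where
  "multilinear_mult L M N A =
     (\<chi> p q r. \<Sum>i\<in>UNIV. \<Sum>j\<in>UNIV. \<Sum>k\<in>UNIV. L $ p $ i * M $ q $ j * N $ r $ k * A $ i $ j $ k)"

text \<open>
  The elements of the index type \<open>2\<close> are \<open>1\<close> and \<open>2\<close> (with \<open>2 = 0\<close>), so \<open>axis 1 1\<close> and
  \<open>axis 2 1\<close> are the two standard basis vectors.
\<close>

definition G3 :: "real ^ 2 ^ 2 ^ 2" where
  "G3 = (let e1 = axis 1 1; e2 = axis 2 1 in
     outer e1 e1 e1 + outer e1 e2 e2 - outer e2 e1 e2 + outer e2 e2 e1)"

text \<open>
  A finite index type carries no distinguished first and second element, so the maps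
  \<open>\<iota>1\<close>, \<open>\<iota>2\<close>, \<open>\<iota>3\<close> (meant to be injective) say which two indices of each mode play these roles;
  all other entries of the padded array are zero.
\<close>

definition pad :: "(2 \<Rightarrow> 'd1) \<Rightarrow> (2 \<Rightarrow> 'd2) \<Rightarrow> (2 \<Rightarrow> 'd3) \<Rightarrow> real ^ 2 ^ 2 ^ 2 \<Rightarrow>
    real ^ 'd3 ^ 'd2 ^ 'd1" where
  "pad \<iota>1 \<iota>2 \<iota>3 A = (\<chi> i j k.
     if i \<in> range \<iota>1 \<and> j \<in> range \<iota>2 \<and> k \<in> range \<iota>3
     then A $ (inv \<iota>1 i) $ (inv \<iota>2 j) $ (inv \<iota>3 k) else 0)"

definition type_G3 :: "(2 \<Rightarrow> 'd1) \<Rightarrow> (2 \<Rightarrow> 'd2) \<Rightarrow> (2 \<Rightarrow> 'd3) \<Rightarrow>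
    real ^ 'd3 ^ 'd2 ^ 'd1 \<Rightarrow> bool" where
  "type_G3 \<iota>1 \<iota>2 \<iota>3 A \<longleftrightarrow>
     (\<exists>(L :: real ^ 'd1 ^ 'd1) (M :: real ^ 'd2 ^ 'd2) (N :: real ^ 'd3 ^ 'd3).
        invertible L \<and> invertible M \<and> invertible N \<and>
        A = multilinear_mult L M N (pad \<iota>1 \<iota>2 \<iota>3 G3))"

definition has_best_rank_approx :: "nat \<Rightarrow> real ^ 'd3 ^ 'd2 ^ 'd1 \<Rightarrow> bool" where
  "has_best_rank_approx r A \<longleftrightarrow>
     (\<exists>B. outer_rank B \<le> r \<and>
        frobenius_norm (A - B) = (INF C\<in>{C. outer_rank C \<le> r}. frobenius_norm (A - C)))"

end

theory Submission
  imports Defs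
begin

text \<open>
  Let \<open>B = a\<^sub>1 \<otimes> b\<^sub>1 \<otimes> c\<^sub>1 + a\<^sub>2 \<otimes> b\<^sub>2 \<otimes> c\<^sub>2\<close> be a best approximation of \<open>A\<close>. If the vectors in each mode
  are independent, stationarity says that \<open>A - B\<close> is orthogonal to every tensor obtained from a
  summand of \<open>B\<close> by changing one factor, hence to all \<open>a\<^sub>i \<otimes> b\<^sub>j \<otimes> c\<^sub>k\<close>: \<open>B\<close> is the
  projection of \<open>A\<close> to a \<open>2 \<times> 2 \<times> 2\<close> block. If the vectors in some mode are dependent,
  a slice \<open>u \<otimes> A(u)\<close> is at least as close to \<open>A\<close> as \<open>B\<close>. Both conclusions involve only orthonormal
  vectors, so by compactness they define closed sets of tensors \<open>A\<close>. A tensor of type \<open>G\<^sub>3\<close> lies in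
  none of them: its pencil of slices is definite, so a slice \<open>A(u)\<close> has enough two-term
  decompositions to be improved, and a block with singular slice \<open>A(u\<^sub>1)\<close> collapses in one of the
  modes. The complement of these closed sets is the required neighbourhood.
\<close>

section \<open>Splitting off the first mode: products and contractions\<close>

definition tprod :: "real ^ 'n \<Rightarrow> 'w::real_inner \<Rightarrow> 'w ^ 'n" where
  "tprod u N = (\<chi> i. u $ i *\<^sub>R N)"

text \<open>The adjoint of \<open>tprod u\<close>, by \<open>inner_tprod\<close>. Entries in an
  arbitrary inner product space let the same pair split off a mode of a tensor and then of the
  remaining matrix.\<close>

definition contr :: "'w::real_inner ^ 'n \<Rightarrow> real ^ 'n \<Rightarrow> 'w" where
  "contr A u = (\<Sum>i\<in>UNIV. u $ i *\<^sub>R A $ i)"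

lemma outer_eq_tprod: "outer x y z = tprod x (tprod y z)"
  by (simp add: outer_def tprod_def vec_eq_iff mult.assoc)

lemma tprod_add_left: "tprod (x + y) N = tprod x N + tprod y N"
  and tprod_add_right: "tprod x (M + N) = tprod x M + tprod x N"
  and tprod_diff_left: "tprod (x - y) N = tprod x N - tprod y N"
  and tprod_diff_right: "tprod x (M - N) = tprod x M - tprod x N"
  and tprod_scale_left: "tprod (c *\<^sub>R x) N = c *\<^sub>R tprod x N"
  and tprod_scale_right: "tprod x (c *\<^sub>R N) = c *\<^sub>R tprod x N"
  and tprod_minus_left: "tprod (- x) N = - tprod x N"
  and tprod_minus_right: "tprod x (- N) = - tprod x N"
  and tprod_zero_left: "tprod 0 N = 0"
  and tprod_zero_right: "tprod x 0 = 0"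
  by (simp_all add: tprod_def vec_eq_iff algebra_simps)

lemmas tprod_linear = tprod_add_left tprod_add_right tprod_diff_left tprod_diff_right
  tprod_scale_left tprod_scale_right tprod_minus_left tprod_minus_right
  tprod_zero_left tprod_zero_right

lemma inner_tprod: "A \<bullet> tprod u N = contr A u \<bullet> N"
  by (simp add: inner_vec_def tprod_def contr_def inner_sum_left)

lemma contr_tprod: "contr (tprod x N) u = (x \<bullet> u) *\<^sub>R N"
  by (simp add: contr_def tprod_def inner_vec_def scaleR_sum_left mult.commute)

lemma contr_add: "contr (A + B) u = contr A u + contr B u"
  and contr_diff: "contr (A - B) u = contr A u - contr B u"
  and contr_scale: "contr (c *\<^sub>R A) u = c *\<^sub>R contr A u"
  by (simp_all add: contr_def algebra_simps sum.distrib sum_subtractf scaleR_sum_right)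

lemma inner_outer_outer: "outer a b c \<bullet> outer x y z = (a \<bullet> x) * (b \<bullet> y) * (c \<bullet> z)"
  by (simp add: outer_eq_tprod inner_tprod contr_tprod contr_scale)

lemma frobenius_norm_eq_norm: "frobenius_norm A = norm A"
  by (simp add: frobenius_norm_def norm_eq_sqrt_inner inner_vec_def power2_eq_square)

text \<open>Orthogonal projection: the two sides differ by the squared norm of
  \<open>contr A u - N\<close>.\<close>

lemma norm_diff_tprod_ge:
  assumes "norm u = 1"
  shows "(norm A)\<^sup>2 - (norm (contr A u))\<^sup>2 \<le> (norm (A - tprod u N))\<^sup>2"
proof -
  have uu: "u \<bullet> u = 1" using assms by (simp add: norm_eq_1)
  have "0 \<le> (norm (contr A u - N))\<^sup>2" by simp
  moreover have "N \<bullet> contr A u = contr A u \<bullet> N" by (rule inner_commute)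
  moreover have "tprod u N \<bullet> A = contr A u \<bullet> N" by (metis inner_commute inner_tprod)
  ultimately show ?thesis
    by (simp add: power2_norm_eq_inner inner_diff_left inner_diff_right inner_tprod contr_diff
        contr_tprod uu)
qed

lemma norm_diff_tprod_contr:
  assumes "norm u = 1"
  shows "(norm (A - tprod u (contr A u)))\<^sup>2 = (norm A)\<^sup>2 - (norm (contr A u))\<^sup>2"
proof -
  have uu: "u \<bullet> u = 1" using assms by (simp add: norm_eq_1)
  have "tprod u (contr A u) \<bullet> A = contr A u \<bullet> contr A u" by (metis inner_commute inner_tprod)
  then show ?thesis
    by (simp add: power2_norm_eq_inner inner_diff_left inner_diff_right inner_tprod contr_diff
        contr_tprod uu)
qed

text \<open>First-order condition along a line: the \<open>t\<close> chosen below minimises the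
  quadratic and lowers it by \<open>(E \<bullet> D)\<^sup>2 / (D \<bullet> D)\<close>.\<close>

lemma inner_eq_0_if_norm_minimal:
  fixes E D :: "'a::real_inner"
  assumes "\<And>t. norm E \<le> norm (E - t *\<^sub>R D)"
  shows "E \<bullet> D = 0"
proof (cases "D = 0")
  case False
  define t where "t = (E \<bullet> D) / (D \<bullet> D)"
  have pos: "D \<bullet> D > 0" using False by simp
  have "(norm E)\<^sup>2 \<le> (norm (E - t *\<^sub>R D))\<^sup>2" using assms by (simp add: power_mono)
  then have "2 * t * (E \<bullet> D) \<le> t * t * (D \<bullet> D)"
    by (simp add: power2_norm_eq_inner inner_diff_left inner_diff_right inner_commute)
  also have "t * t * (D \<bullet> D) = t * (E \<bullet> D)" using pos by (simp add: t_def)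
  finally have "(E \<bullet> D)\<^sup>2 / (D \<bullet> D) \<le> 0" by (simp add: t_def power2_eq_square)
  then show ?thesis using pos by (simp add: divide_le_0_iff)
qed simp

section \<open>Orthonormal and independent pairs\<close>

definition orthonormal2 :: "'a::real_inner \<Rightarrow> 'a \<Rightarrow> bool" where
  "orthonormal2 u v \<longleftrightarrow> u \<bullet> u = 1 \<and> v \<bullet> v = 1 \<and> u \<bullet> v = 0"

definition indep2 :: "'a::real_vector \<Rightarrow> 'a \<Rightarrow> bool" where
  "indep2 x y \<longleftrightarrow> (\<forall>s t. s *\<^sub>R x + t *\<^sub>R y = 0 \<longrightarrow> s = 0 \<and> t = 0)"

text \<open>The gap is the squared norm of what remains of \<open>K\<close> after removing its
  components along \<open>v\<close> and \<open>w\<close> in the first mode.\<close>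

lemma bessel_contr:
  assumes "orthonormal2 v w"
  shows "(norm (contr K v))\<^sup>2 + (norm (contr K w))\<^sup>2 \<le> (norm K)\<^sup>2"
proof -
  have vw: "v \<bullet> v = 1" "w \<bullet> w = 1" "v \<bullet> w = 0" "w \<bullet> v = 0"
    using assms by (auto simp: orthonormal2_def inner_commute)
  have "tprod v N \<bullet> K = contr K v \<bullet> N" "tprod w N \<bullet> K = contr K w \<bullet> N" for N
    by (metis inner_commute inner_tprod)+
  then have "(norm (K - tprod v (contr K v) - tprod w (contr K w)))\<^sup>2
     = (norm K)\<^sup>2 - (norm (contr K v))\<^sup>2 - (norm (contr K w))\<^sup>2"
    by (simp add: power2_norm_eq_inner inner_diff_left inner_diff_right inner_tprod contr_tprod
        contr_diff vw)
  then show ?thesis by (smt (verit) zero_le_power2)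
qed

lemma bessel_vec:
  fixes z v w :: "'a::real_inner"
  assumes "orthonormal2 v w"
  shows "(z \<bullet> v)\<^sup>2 + (z \<bullet> w)\<^sup>2 \<le> (norm z)\<^sup>2"
proof -
  have vw: "v \<bullet> v = 1" "w \<bullet> w = 1" "v \<bullet> w = 0" "w \<bullet> v = 0"
    using assms by (auto simp: orthonormal2_def inner_commute)
  have "(norm (z - (z \<bullet> v) *\<^sub>R v - (z \<bullet> w) *\<^sub>R w))\<^sup>2 = (norm z)\<^sup>2 - (z \<bullet> v)\<^sup>2 - (z \<bullet> w)\<^sup>2"
    unfolding power2_norm_eq_inner
    by (simp add: inner_diff_left inner_diff_right vw inner_commute power2_eq_square)
  then show ?thesis by (smt (verit) zero_le_power2)
qed

lemma bessel_outer:
  assumes "orthonormal2 v1 v2" "orthonormal2 w1 w2"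
  shows "(A \<bullet> outer u v1 w1)\<^sup>2 + (A \<bullet> outer u v1 w2)\<^sup>2 + (A \<bullet> outer u v2 w1)\<^sup>2
    + (A \<bullet> outer u v2 w2)\<^sup>2 \<le> (norm (contr A u))\<^sup>2"
  using bessel_contr[OF assms(1), of "contr A u"]
    bessel_vec[OF assms(2), of "contr (contr A u) v1"]
    bessel_vec[OF assms(2), of "contr (contr A u) v2"]
  by (simp add: outer_eq_tprod inner_tprod)

text \<open>Gram-Schmidt starting from \<open>a\<close>: \<open>u\<close> is orthogonal to
  \<open>a\<close>, so the argument order decides which vector has a single coordinate. The
  dependent case includes zero vectors.\<close>

lemma gram_schmidt2:
  fixes a b :: "real ^ 'n"
  obtains (dependent) e s t where "norm e = 1" "a = s *\<^sub>R e" "b = t *\<^sub>R e"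
  | (independent) u v \<alpha> \<beta> \<gamma> where "orthonormal2 u v" "\<alpha> \<noteq> 0" "\<beta> \<noteq> 0"
      "a = \<alpha> *\<^sub>R v" "b = \<beta> *\<^sub>R u + \<gamma> *\<^sub>R v"
proof (cases "a = 0")
  case True
  show ?thesis
  proof (cases "b = 0")
    case b: True
    show ?thesis
      by (rule dependent[of "axis undefined 1" 0 0]) (simp_all add: True b)
  next
    case False
    show ?thesis
      by (rule dependent[of "b /\<^sub>R norm b" 0 "norm b"]) (simp_all add: True False)
  qed
next
  case False
  define v where "v = a /\<^sub>R norm a"
  have nv: "norm v = 1" and av: "a = norm a *\<^sub>R v" using False by (simp_all add: v_def)
  define d where "d = b - (b \<bullet> v) *\<^sub>R v"
  have vv: "v \<bullet> v = 1" using nv by (simp add: norm_eq_1)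
  have dv: "d \<bullet> v = 0" by (simp add: d_def inner_diff_left vv)
  show ?thesis
  proof (cases "d = 0")
    case True
    show ?thesis by (rule dependent[OF nv av, of "b \<bullet> v"]) (use True in \<open>simp add: d_def\<close>)
  next
    case d: False
    define u where "u = d /\<^sub>R norm d"
    have "norm u = 1" using d by (simp add: u_def)
    then have "u \<bullet> u = 1" by (simp add: norm_eq_1)
    moreover have "u \<bullet> v = 0" by (simp add: u_def dv)
    ultimately have "orthonormal2 u v" by (simp add: orthonormal2_def vv)
    moreover have "b = norm d *\<^sub>R u + (b \<bullet> v) *\<^sub>R v" using d by (simp add: u_def d_def)
    ultimately show ?thesis using independent False d av norm_eq_zero by metis
  qed
qed

text \<open>Column \<open>k\<close> of the matrix is
  \<open>r1 $ k *\<^sub>R m1 + r2 $ k *\<^sub>R m2\<close>, so independence applies column by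
  column.\<close>

lemma tprod_sum_eq_0:
  fixes r1 r2 :: "real ^ 'm"
  assumes "indep2 m1 m2" "tprod m1 r1 + tprod m2 r2 = 0"
  shows "r1 = 0" "r2 = 0"
proof -
  have "r1 $ k *\<^sub>R m1 + r2 $ k *\<^sub>R m2 = 0" for k
    using assms(2) by (auto simp: vec_eq_iff tprod_def mult.commute)
  then have "r1 $ k = 0 \<and> r2 $ k = 0" for k using assms(1) by (auto simp: indep2_def)
  then show "r1 = 0" "r2 = 0" by (simp_all add: vec_eq_iff)
qed

section \<open>Two-term sums and the optimality conditions\<close>

definition rank_le_2 :: "(real ^ 'd3 ^ 'd2 ^ 'd1) set" where
  "rank_le_2 = {outer a1 b1 c1 + outer a2 b2 c2 | a1 b1 c1 a2 b2 c2. True}"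

lemma rank_le_2I: "outer a1 b1 c1 + outer a2 b2 c2 \<in> rank_le_2"
  unfolding rank_le_2_def by blast

text \<open>
  The left-hand side is the squared distance from \<open>A\<close> to its slice \<open>u \<otimes> A(u)\<close>, the nearest
  tensor of the form \<open>u \<otimes> N\<close>; the slice itself need not have rank at most 2.
\<close>

definition opt_slice :: "real ^ 'd3 ^ 'd2 ^ 'd1 \<Rightarrow> real ^ 'd1 \<Rightarrow> bool" where
  "opt_slice A u \<longleftrightarrow> norm u = 1 \<and>
     (\<forall>C\<in>rank_le_2. (norm A)\<^sup>2 - (norm (contr A u))\<^sup>2 \<le> (norm (A - C))\<^sup>2)"

text \<open>
  The bracketed sum is the squared norm of the projection of \<open>A\<close> to the span of the
  \<open>u\<^sub>i \<otimes> v\<^sub>j \<otimes> w\<^sub>k\<close>. The two vanishing entries are a closed condition retaining that the projection is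
  \<open>a\<^sub>1 \<otimes> b\<^sub>1 \<otimes> c\<^sub>1 + a\<^sub>2 \<otimes> b\<^sub>2 \<otimes> c\<^sub>2\<close>: choose \<open>u\<^sub>1\<close> orthogonal to \<open>a\<^sub>1\<close> and \<open>v\<^sub>1\<close> orthogonal to \<open>b\<^sub>2\<close>.
\<close>

definition opt_core :: "real ^ 'd3 ^ 'd2 ^ 'd1 \<Rightarrow> real ^ 'd1 \<Rightarrow> real ^ 'd1 \<Rightarrow> real ^ 'd2 \<Rightarrow> real ^ 'd2 \<Rightarrow>
    real ^ 'd3 \<Rightarrow> real ^ 'd3 \<Rightarrow> bool" where
  "opt_core A u1 u2 v1 v2 w1 w2 \<longleftrightarrow>
     orthonormal2 u1 u2 \<and> orthonormal2 v1 v2 \<and> orthonormal2 w1 w2 \<and>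
     A \<bullet> outer u1 v1 w1 = 0 \<and> A \<bullet> outer u1 v1 w2 = 0 \<and>
     (\<forall>C\<in>rank_le_2. (norm A)\<^sup>2 - (\<Sum>(u, v, w)\<leftarrow>
        [(u1,v2,w1), (u1,v2,w2), (u2,v1,w1), (u2,v1,w2), (u2,v2,w1), (u2,v2,w2)].
        (A \<bullet> outer u v w)\<^sup>2) \<le> (norm (A - C))\<^sup>2)"

section \<open>Permutations of the modes\<close>

definition swap13 :: "'a ^ 'n3 ^ 'n2 ^ 'n1 \<Rightarrow> 'a ^ 'n1 ^ 'n2 ^ 'n3" where
  "swap13 A = (\<chi> k j i. A $ i $ j $ k)"

lemma transpose_outer: "transpose (outer x y z) = outer y x z"
  and swap13_outer: "swap13 (outer x y z) = outer z y x"
  by (simp_all add: transpose_def swap13_def outer_def vec_eq_iff)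

lemma swap13_swap13: "swap13 (swap13 A) = A"
  by (simp add: swap13_def)

lemma transpose_add: "transpose (A + B) = transpose A + transpose B"
  and transpose_diff: "transpose (A - B) = transpose A - transpose B"
  for A B :: "'a::ab_group_add ^ 'n ^ 'm"
  by (simp_all add: transpose_def vec_eq_iff)

lemma swap13_add: "swap13 (A + B) = swap13 A + swap13 B"
  and swap13_diff: "swap13 (A - B) = swap13 A - swap13 B"
  for A B :: "'a::ab_group_add ^ 'n ^ 'm ^ 'k"
  by (simp_all add: swap13_def vec_eq_iff)

lemma inner_transpose_transpose: "transpose A \<bullet> transpose B = A \<bullet> B"
  for A B :: "'a::real_inner ^ 'n ^ 'm"
  by (simp add: inner_vec_def transpose_def) (rule sum.swap)

lemma inner_swap13_swap13: "swap13 A \<bullet> swap13 B = A \<bullet> B"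
  for A B :: "'a::real_inner ^ 'n ^ 'm ^ 'k"
proof -
  have "swap13 A \<bullet> swap13 B = (\<Sum>k\<in>UNIV. \<Sum>j\<in>UNIV. \<Sum>i\<in>UNIV. A $ i $ j $ k \<bullet> B $ i $ j $ k)"
    by (simp add: inner_vec_def swap13_def)
  also have "\<dots> = (\<Sum>k\<in>UNIV. \<Sum>i\<in>UNIV. \<Sum>j\<in>UNIV. A $ i $ j $ k \<bullet> B $ i $ j $ k)"
    by (intro sum.cong refl sum.swap)
  also have "\<dots> = (\<Sum>i\<in>UNIV. \<Sum>k\<in>UNIV. \<Sum>j\<in>UNIV. A $ i $ j $ k \<bullet> B $ i $ j $ k)"
    by (rule sum.swap)
  also have "\<dots> = (\<Sum>i\<in>UNIV. \<Sum>j\<in>UNIV. \<Sum>k\<in>UNIV. A $ i $ j $ k \<bullet> B $ i $ j $ k)"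
    by (intro sum.cong refl sum.swap)
  finally show ?thesis by (simp add: inner_vec_def)
qed

lemma norm_transpose: "norm (transpose A) = norm A" for A :: "'a::real_inner ^ 'n ^ 'm"
  by (simp add: norm_eq_sqrt_inner inner_transpose_transpose)

lemma norm_swap13: "norm (swap13 A) = norm A" for A :: "'a::real_inner ^ 'n ^ 'm ^ 'k"
  by (simp add: norm_eq_sqrt_inner inner_swap13_swap13)

lemma inner_transpose_outer: "transpose A \<bullet> outer y x z = A \<bullet> outer x y z"
  by (metis transpose_outer inner_transpose_transpose)

lemma inner_swap13_outer: "swap13 A \<bullet> outer z y x = A \<bullet> outer x y z"
  by (metis swap13_outer inner_swap13_swap13)

lemma transpose_rank_le_2: "C \<in> rank_le_2 \<Longrightarrow> transpose C \<in> rank_le_2"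
  and swap13_rank_le_2: "D \<in> rank_le_2 \<Longrightarrow> swap13 D \<in> rank_le_2"
  unfolding rank_le_2_def
  by (clarsimp simp: transpose_add swap13_add transpose_outer swap13_outer, blast)+

lemma norm_transpose_diff: "norm (transpose A - C) = norm (A - transpose C)"
  for A :: "'a::real_inner ^ 'n ^ 'm"
  by (metis norm_transpose transpose_diff transpose_transpose)

lemma norm_swap13_diff: "norm (swap13 A - C) = norm (A - swap13 C)"
  for A :: "'a::real_inner ^ 'n ^ 'm ^ 'k"
  by (metis norm_swap13 swap13_diff swap13_swap13)

section \<open>Failure of the optimality conditions at tensors of type G3\<close>

text \<open>\<open>G3\<close> with arbitrary vectors in place of the standard bases. With each plane
  read as the complex numbers, \<open>G3\<close> is the bilinear map taking x and y to conj(x)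
  y.\<close>

definition g3_form where
  "g3_form l1 l2 m1 m2 n1 n2 =
     outer l1 m1 n1 + outer l1 m2 n2 - outer l2 m1 n2 + outer l2 m2 n1"

text \<open>
  Up to a sign the form is symmetric in the three modes, so that statements about the first mode
  transfer to the other two.
\<close>

lemma transpose_g3_form:
  "transpose (g3_form l1 l2 m1 m2 n1 n2) = g3_form m1 m2 l1 l2 n1 (- n2)"
  by (simp add: g3_form_def transpose_add transpose_diff transpose_outer)
     (simp add: outer_def vec_eq_iff)

lemma swap13_g3_form:
  "swap13 (g3_form l1 l2 m1 m2 n1 n2) = g3_form n1 n2 m1 m2 l1 l2"
  by (simp add: g3_form_def swap13_add swap13_diff swap13_outer)

text \<open>With \<open>pj = lj \<bullet> u\<close>, the factors paired with \<open>m1\<close> and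
  \<open>m2\<close> are the real and imaginary parts of (p1 + i p2)(n1 + i n2). Division by a
  nonzero complex number is the definiteness of the pencil.\<close>

lemma contr_g3_form:
  "contr (g3_form l1 l2 m1 m2 n1 n2) u =
     tprod m1 ((l1 \<bullet> u) *\<^sub>R n1 - (l2 \<bullet> u) *\<^sub>R n2) + tprod m2 ((l1 \<bullet> u) *\<^sub>R n2 + (l2 \<bullet> u) *\<^sub>R n1)"
  by (simp add: g3_form_def contr_add contr_diff outer_eq_tprod contr_tprod tprod_linear
      algebra_simps)

lemma indep2_nonzero: "indep2 x y \<Longrightarrow> x \<noteq> 0"
  unfolding indep2_def by (metis add.right_neutral scaleR_one scaleR_zero_left zero_neq_one)

lemma indep2_minus: "indep2 x y \<Longrightarrow> indep2 x (- y)"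
  unfolding indep2_def by (metis neg_equal_0_iff_equal scaleR_minus_left scaleR_minus_right)

lemma contr_g3_form_eq_0:
  assumes "contr (g3_form l1 l2 m1 m2 n1 n2) u = 0" "indep2 m1 m2" "indep2 n1 n2"
  shows "l1 \<bullet> u = 0" "l2 \<bullet> u = 0"
proof -
  have "(l1 \<bullet> u) *\<^sub>R n1 - (l2 \<bullet> u) *\<^sub>R n2 = 0"
    using tprod_sum_eq_0 assms by (metis contr_g3_form)
  then have "(l1 \<bullet> u) *\<^sub>R n1 + (- (l2 \<bullet> u)) *\<^sub>R n2 = 0" by simp
  then show "l1 \<bullet> u = 0" "l2 \<bullet> u = 0" using assms(3) unfolding indep2_def by (metis neg_equal_0_iff_equal)+
qed

text \<open>Optimality makes the residual orthogonal to so many products that, for some nonzero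
  \<open>x\<close> in the span of \<open>l1, l2\<close> orthogonal to \<open>u\<close>, the slice
  \<open>contr A x\<close> is orthogonal to all \<open>m\<^sub>i \<otimes> n\<^sub>j\<close>. It
  lies in their span, so it vanishes, which forces \<open>x = 0\<close>.\<close>

lemma not_opt_slice_g3_form:
  assumes l: "indep2 l1 l2" and m: "indep2 m1 m2" and n: "indep2 n1 n2"
  shows "\<not> opt_slice (g3_form l1 l2 m1 m2 n1 n2) u"
proof
  define A where "A = g3_form l1 l2 m1 m2 n1 n2"
  assume "opt_slice (g3_form l1 l2 m1 m2 n1 n2) u"
  then have u: "norm u = 1"
    and opt: "\<And>C. C \<in> rank_le_2 \<Longrightarrow> (norm A)\<^sup>2 - (norm (contr A u))\<^sup>2 \<le> (norm (A - C))\<^sup>2"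
    by (auto simp: opt_slice_def A_def)
  define E where "E = A - tprod u (contr A u)"
  \<comment> \<open>One summand of a two-term decomposition can have its factor \<open>u\<close>
    moved to \<open>u + t *\<^sub>R x\<close> without creating a third term.\<close>
  have perp: "E \<bullet> outer x y1 z1 = 0" if dec: "contr A u = tprod y1 z1 + tprod y2 z2" for x y1 z1 y2 z2
  proof (rule inner_eq_0_if_norm_minimal)
    fix t
    have "tprod u (contr A u) + t *\<^sub>R outer x y1 z1
        = outer (u + t *\<^sub>R x) y1 z1 + outer u y2 z2"
      by (simp add: dec outer_eq_tprod tprod_linear)
    then have "tprod u (contr A u) + t *\<^sub>R outer x y1 z1 \<in> rank_le_2"
      by (simp add: rank_le_2I)
    from opt[OF this] have "(norm E)\<^sup>2 \<le> (norm (E - t *\<^sub>R outer x y1 z1))\<^sup>2"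
      unfolding E_def norm_diff_tprod_contr[OF u] by (simp only: diff_diff_eq)
    then show "norm E \<le> norm (E - t *\<^sub>R outer x y1 z1)"
      by (rule power2_le_imp_le) simp
  qed
  define p1 p2 where "p1 = l1 \<bullet> u" and "p2 = l2 \<bullet> u"
  define r1 r2 where "r1 = p1 *\<^sub>R n1 - p2 *\<^sub>R n2" and "r2 = p1 *\<^sub>R n2 + p2 *\<^sub>R n1"
  have H: "contr A u = tprod m1 r1 + tprod m2 r2"
    by (simp add: A_def contr_g3_form r1_def r2_def p1_def p2_def)
  have "\<exists>x. x \<bullet> u = 0 \<and> x \<noteq> 0 \<and> (\<exists>s t. x = s *\<^sub>R l1 + t *\<^sub>R l2) \<and>
    (\<forall>m\<in>{m1, m2}. \<forall>n\<in>{n1, n2}. E \<bullet> outer x m n = 0)"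
  proof (cases "p1 = 0 \<and> p2 = 0")
    case True
    then have "contr A u = 0" by (simp add: H r1_def r2_def tprod_linear)
    \<comment> \<open>The zero matrix splits as a product plus its negative, so every
      \<open>m\<close> and \<open>n\<close> is available to \<open>perp\<close>.\<close>
    then have *: "contr A u = tprod m n + tprod (- m) n" for m :: "real ^ 'b" and n :: "real ^ 'c"
      by (simp add: tprod_linear)
    have "E \<bullet> outer l1 m n = 0" for m n using perp[OF *] .
    moreover have "l1 = 1 *\<^sub>R l1 + 0 *\<^sub>R l2" by simp
    ultimately show ?thesis using True indep2_nonzero[OF l] unfolding p1_def by blast
  next
    case False
    define q where "q = p1 * p1 + p2 * p2"
    have q: "q \<noteq> 0" using False by (simp add: q_def)
    \<comment> \<open>Each summand of a two-term decomposition of \<open>A(u)\<close> can be perturbed; shearing the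
      decomposition makes every \<open>m\<^sub>i \<otimes> r\<^sub>j\<close> such a summand.\<close>
    have H': "contr A u = tprod m2 r2 + tprod m1 r1"
      "contr A u = tprod m1 (r1 - r2) + tprod (m1 + m2) r2"
      "contr A u = tprod m2 (r2 - r1) + tprod (m1 + m2) r1"
      by (simp_all add: H tprod_linear)
    have "E \<bullet> outer x m1 r1 = 0" "E \<bullet> outer x m1 (r1 - r2) = 0"
      "E \<bullet> outer x m2 r2 = 0" "E \<bullet> outer x m2 (r2 - r1) = 0" for x
      by (fact perp[OF H] perp[OF H'(1)] perp[OF H'(2)] perp[OF H'(3)])+
    then have Er: "E \<bullet> outer x m1 r1 = 0" "E \<bullet> outer x m1 r2 = 0"
      "E \<bullet> outer x m2 r2 = 0" "E \<bullet> outer x m2 r1 = 0" for x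
      by (simp_all add: outer_eq_tprod tprod_linear inner_diff_right)
    \<comment> \<open>Multiplying r1 + i r2 by the conjugate of p1 + i p2 recovers \<open>n1\<close>
      and \<open>n2\<close> up to the factor \<open>q\<close>.\<close>
    have "p1 *\<^sub>R r1 + p2 *\<^sub>R r2 = q *\<^sub>R n1" "p1 *\<^sub>R r2 - p2 *\<^sub>R r1 = q *\<^sub>R n2"
      by (simp_all add: r1_def r2_def q_def algebra_simps)
    moreover have "E \<bullet> outer x m (p1 *\<^sub>R r1 + p2 *\<^sub>R r2) = 0" "E \<bullet> outer x m (p1 *\<^sub>R r2 - p2 *\<^sub>R r1) = 0"
      if "m \<in> {m1, m2}" for x m
      using that Er[of x] by (auto simp: outer_eq_tprod tprod_linear inner_diff_right inner_add_right)
    ultimately have "E \<bullet> outer x m (q *\<^sub>R n1) = 0" "E \<bullet> outer x m (q *\<^sub>R n2) = 0"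
      if "m \<in> {m1, m2}" for x m
      using that by metis+
    then have *: "\<forall>m\<in>{m1, m2}. \<forall>n\<in>{n1, n2}. E \<bullet> outer x m n = 0" for x
      using q by (simp add: outer_eq_tprod tprod_linear)
    \<comment> \<open>The direction in the plane of \<open>l1\<close> and \<open>l2\<close> that is
      orthogonal to \<open>u\<close>.\<close>
    define x where "x = p2 *\<^sub>R l1 + (- p1) *\<^sub>R l2"
    have "x \<bullet> u = 0" by (simp add: x_def inner_diff_left p1_def p2_def mult.commute)
    moreover have "x \<noteq> 0" using l False unfolding indep2_def x_def by (metis neg_equal_0_iff_equal)
    ultimately show ?thesis using * x_def by blast
  qed
  then obtain x s t where x: "x \<bullet> u = 0" "x \<noteq> 0" "x = s *\<^sub>R l1 + t *\<^sub>R l2"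
    and Ex: "\<And>m n. m \<in> {m1, m2} \<Longrightarrow> n \<in> {n1, n2} \<Longrightarrow> E \<bullet> outer x m n = 0"
    by blast
  \<comment> \<open>As \<open>x\<close> is orthogonal to \<open>u\<close>, the subtracted slice
    contributes nothing in direction \<open>x\<close>.\<close>
  have Ax: "contr A x \<bullet> tprod m n = 0" if "m \<in> {m1, m2}" "n \<in> {n1, n2}" for m n
    using Ex[OF that] x(1)
    by (simp add: E_def inner_diff_left outer_eq_tprod inner_tprod contr_diff contr_tprod contr_scale
        inner_commute[of u x])
  have "contr A x = tprod m1 ((l1 \<bullet> x) *\<^sub>R n1 - (l2 \<bullet> x) *\<^sub>R n2) +
      tprod m2 ((l1 \<bullet> x) *\<^sub>R n2 + (l2 \<bullet> x) *\<^sub>R n1)"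
    by (simp add: A_def contr_g3_form)
  from arg_cong[OF this, of "\<lambda>K. contr A x \<bullet> K"] have "contr A x \<bullet> contr A x = 0"
    by (simp add: tprod_linear inner_add_right inner_diff_right Ax)
  then have "contr A x = 0" by simp
  then have "l1 \<bullet> x = 0" "l2 \<bullet> x = 0" using contr_g3_form_eq_0[OF _ m n] by (auto simp: A_def)
  then have "x \<bullet> x = 0" by (subst x(3)) (simp add: inner_add_left)
  then show False using x(2) by simp
qed

text \<open>By Bessel the full slice captures at least as much of \<open>A\<close> as these four
  entries, so it inherits the bound.\<close>

lemma opt_slice_if_orthonormal:
  assumes u: "norm u = 1" and "orthonormal2 v1 v2" "orthonormal2 w1 w2"
    and "\<And>C. C \<in> rank_le_2 \<Longrightarrow> (norm A)\<^sup>2 - ((A \<bullet> outer u v1 w1)\<^sup>2 + (A \<bullet> outer u v1 w2)\<^sup>2 +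
      (A \<bullet> outer u v2 w1)\<^sup>2 + (A \<bullet> outer u v2 w2)\<^sup>2) \<le> (norm (A - C))\<^sup>2"
  shows "opt_slice A u"
  unfolding opt_slice_def
  using u bessel_outer[OF assms(2,3), of A u] assms(4) by (smt (verit))

text \<open>Rotate the plane until \<open>(x, y)\<close> lies on an axis.\<close>

lemma ex_unit_combination:
  "\<exists>\<alpha> \<beta>. \<alpha>\<^sup>2 + \<beta>\<^sup>2 = 1 \<and> (\<alpha> * x + \<beta> * y)\<^sup>2 = x\<^sup>2 + y\<^sup>2" for x y :: real
proof (cases "x\<^sup>2 + y\<^sup>2 = 0")
  case True
  then have "x = 0" "y = 0" by (simp_all add: sum_power2_eq_zero_iff)
  then show ?thesis by (intro exI[of _ 1] exI[of _ 0]) simp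
next
  case False
  define r where "r = sqrt (x\<^sup>2 + y\<^sup>2)"
  have r: "r\<^sup>2 = x\<^sup>2 + y\<^sup>2" "r \<noteq> 0" using False by (simp_all add: r_def)
  have "(x / r)\<^sup>2 + (y / r)\<^sup>2 = 1" using r False by (simp add: power_divide add_divide_distrib[symmetric])
  moreover have "x / r * x + y / r * y = r"
    using r by (simp add: power2_eq_square add_divide_distrib[symmetric] divide_simps)
  ultimately show ?thesis using r(1) by metis
qed

text \<open>The two bracketed coefficients are the real and imaginary parts of the conjugate of
  (l1.x + i l2.x) times (m1.y + i m2.y).\<close>

lemma inner_g3_form_outer:
  "g3_form l1 l2 m1 m2 n1 n2 \<bullet> outer x y z =
     ((l1 \<bullet> x) * (m1 \<bullet> y) + (l2 \<bullet> x) * (m2 \<bullet> y)) * (n1 \<bullet> z) +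
     ((l1 \<bullet> x) * (m2 \<bullet> y) - (l2 \<bullet> x) * (m1 \<bullet> y)) * (n2 \<bullet> z)"
  by (simp add: g3_form_def inner_add_left inner_diff_left inner_outer_outer algebra_simps)

text \<open>The vanishing entries make one mode of the block degenerate. All its squared entries
  then sit in a single slice of that mode, which would be optimal, against
  \<open>not_opt_slice_g3_form\<close>.\<close>

lemma not_opt_core_g3_form:
  assumes l: "indep2 l1 l2" and m: "indep2 m1 m2" and n: "indep2 n1 n2"
  shows "\<not> opt_core (g3_form l1 l2 m1 m2 n1 n2) u1 u2 v1 v2 w1 w2"
proof
  define A where "A = g3_form l1 l2 m1 m2 n1 n2"
  assume "opt_core (g3_form l1 l2 m1 m2 n1 n2) u1 u2 v1 v2 w1 w2"
  then have u: "orthonormal2 u1 u2" and v: "orthonormal2 v1 v2" and w: "orthonormal2 w1 w2"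
    and A0: "A \<bullet> outer u1 v1 w1 = 0" "A \<bullet> outer u1 v1 w2 = 0"
    and opt: "\<And>C. C \<in> rank_le_2 \<Longrightarrow> (norm A)\<^sup>2 - ((A \<bullet> outer u1 v2 w1)\<^sup>2 +
       (A \<bullet> outer u1 v2 w2)\<^sup>2 + (A \<bullet> outer u2 v1 w1)\<^sup>2 + (A \<bullet> outer u2 v1 w2)\<^sup>2 +
       (A \<bullet> outer u2 v2 w1)\<^sup>2 + (A \<bullet> outer u2 v2 w2)\<^sup>2) \<le> (norm (A - C))\<^sup>2"
    by (auto simp: opt_core_def A_def add.assoc)
  note inner_A = inner_g3_form_outer[of l1 l2 m1 m2 n1 n2, folded A_def]
  have no_slice: "\<not> opt_slice A x" "\<not> opt_slice (transpose A) y" "\<not> opt_slice (swap13 A) z" for x y z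
    unfolding A_def transpose_g3_form swap13_g3_form
    using not_opt_slice_g3_form indep2_minus assms by blast+
  have units: "norm u2 = 1" "norm v2 = 1"
    using u v by (auto simp: orthonormal2_def norm_eq_1)
  \<comment> \<open>\<open>A(u\<^sub>1, v\<^sub>1) = s1 n\<^sub>1 + s2 n\<^sub>2\<close> is a complex product, so it vanishes only if a factor does;
    otherwise it is a nonzero vector orthogonal to \<open>w\<^sub>1, w\<^sub>2\<close>, and the third mode degenerates.\<close>
  define s1 s2 where "s1 = (l1 \<bullet> u1) * (m1 \<bullet> v1) + (l2 \<bullet> u1) * (m2 \<bullet> v1)"
    and "s2 = (l1 \<bullet> u1) * (m2 \<bullet> v1) - (l2 \<bullet> u1) * (m1 \<bullet> v1)"
  define q where "q = s1\<^sup>2 + s2\<^sup>2"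
  \<comment> \<open>Multiplicativity of the squared complex modulus.\<close>
  have "q = ((l1 \<bullet> u1)\<^sup>2 + (l2 \<bullet> u1)\<^sup>2) * ((m1 \<bullet> v1)\<^sup>2 + (m2 \<bullet> v1)\<^sup>2)"
    by (simp add: q_def s1_def s2_def power2_eq_square algebra_simps)
  then consider (u) "l1 \<bullet> u1 = 0" "l2 \<bullet> u1 = 0" | (v) "m1 \<bullet> v1 = 0" "m2 \<bullet> v1 = 0" | (w) "q \<noteq> 0"
    by (auto simp: sum_power2_eq_zero_iff)
  then show False
  proof cases
    case u
    then have "A \<bullet> outer u1 y z = 0" for y z by (simp add: inner_A)
    then have "opt_slice A u2"
      using opt by (intro opt_slice_if_orthonormal[OF units(1) v w]) (simp add: add.assoc)
    then show False using no_slice by blast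
  next
    case v
    then have 0: "A \<bullet> outer x v1 z = 0" for x z by (simp add: inner_A)
    have "opt_slice (transpose A) v2"
    proof (rule opt_slice_if_orthonormal[OF units(2) u w])
      fix C :: "real ^ 'c ^ 'a ^ 'b" assume "C \<in> rank_le_2"
      from opt[OF transpose_rank_le_2[OF this]]
      show "(norm (transpose A))\<^sup>2 - ((transpose A \<bullet> outer v2 u1 w1)\<^sup>2 +
          (transpose A \<bullet> outer v2 u1 w2)\<^sup>2 + (transpose A \<bullet> outer v2 u2 w1)\<^sup>2 +
          (transpose A \<bullet> outer v2 u2 w2)\<^sup>2) \<le> (norm (transpose A - C))\<^sup>2"
        by (simp add: 0 inner_transpose_outer norm_transpose norm_transpose_diff)
    qed
    then show False using no_slice by blast
  next
    case w
    \<comment> \<open>For \<open>z\<close> in \<open>{w1, w2}\<close> the pair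
      \<open>(n1 \<bullet> z, n2 \<bullet> z)\<close> is orthogonal to \<open>(s1, s2)\<close>,
      hence \<open>\<kappa> z\<close> times \<open>(- s2, s1)\<close>. So the block entries factor
      as \<open>f x y * \<kappa> z\<close>.\<close>
    define \<kappa> where "\<kappa> z = (s1 * (n2 \<bullet> z) - s2 * (n1 \<bullet> z)) / q" for z
    define f where "f x y = s1 * ((l1 \<bullet> x) * (m2 \<bullet> y) - (l2 \<bullet> x) * (m1 \<bullet> y)) -
      s2 * ((l1 \<bullet> x) * (m1 \<bullet> y) + (l2 \<bullet> x) * (m2 \<bullet> y))" for x y
    have fac: "A \<bullet> outer x y z = f x y * \<kappa> z" if "z \<in> {w1, w2}" for x y z
    proof -
      have "s1 * (n1 \<bullet> z) + s2 * (n2 \<bullet> z) = 0"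
        using that A0 by (auto simp: inner_A s1_def s2_def)
      then have "q * (n1 \<bullet> z) = - s2 * (s1 * (n2 \<bullet> z) - s2 * (n1 \<bullet> z))"
        "q * (n2 \<bullet> z) = s1 * (s1 * (n2 \<bullet> z) - s2 * (n1 \<bullet> z))"
        unfolding q_def by algebra+
      then have "n1 \<bullet> z = - s2 * \<kappa> z" "n2 \<bullet> z = s1 * \<kappa> z"
        using w by (simp_all add: \<kappa>_def field_simps)
      then show ?thesis by (simp add: inner_A f_def algebra_simps)
    qed
    \<comment> \<open>A rotation in the plane of \<open>w1, w2\<close> gives one unit vector
      \<open>z\<close> that carries all the squared block entries.\<close>
    obtain \<alpha> \<beta> where ab: "\<alpha>\<^sup>2 + \<beta>\<^sup>2 = 1" "(\<alpha> * \<kappa> w1 + \<beta> * \<kappa> w2)\<^sup>2 = (\<kappa> w1)\<^sup>2 + (\<kappa> w2)\<^sup>2"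
      using ex_unit_combination by blast
    define z where "z = \<alpha> *\<^sub>R w1 + \<beta> *\<^sub>R w2"
    have "z \<bullet> z = 1" using ab(1) \<open>orthonormal2 w1 w2\<close>
      by (simp add: z_def orthonormal2_def inner_add_left inner_add_right inner_commute power2_eq_square)
    then have "norm z = 1" by (simp add: norm_eq_1)
    have "A \<bullet> outer x y z = f x y * (\<alpha> * \<kappa> w1 + \<beta> * \<kappa> w2)" for x y
      using fac[of w1 x y] fac[of w2 x y]
      by (simp add: z_def outer_eq_tprod tprod_linear inner_add_right algebra_simps)
    then have "(A \<bullet> outer x y z)\<^sup>2 = (f x y)\<^sup>2 * ((\<kappa> w1)\<^sup>2 + (\<kappa> w2)\<^sup>2)" for x y
      by (simp only: power_mult_distrib ab(2))
    then have sq: "(A \<bullet> outer x y z)\<^sup>2 = (A \<bullet> outer x y w1)\<^sup>2 + (A \<bullet> outer x y w2)\<^sup>2" for x y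
      using fac[of w1 x y] fac[of w2 x y] by (simp add: power_mult_distrib distrib_left)
    have "opt_slice (swap13 A) z"
    proof (rule opt_slice_if_orthonormal[OF \<open>norm z = 1\<close> v u])
      fix C :: "real ^ 'a ^ 'b ^ 'c" assume "C \<in> rank_le_2"
      from opt[OF swap13_rank_le_2[OF this]]
      show "(norm (swap13 A))\<^sup>2 - ((swap13 A \<bullet> outer z v1 u1)\<^sup>2 +
          (swap13 A \<bullet> outer z v1 u2)\<^sup>2 + (swap13 A \<bullet> outer z v2 u1)\<^sup>2 +
          (swap13 A \<bullet> outer z v2 u2)\<^sup>2) \<le> (norm (swap13 A - C))\<^sup>2"
        by (simp add: sq A0 inner_swap13_outer norm_swap13 norm_swap13_diff algebra_simps)
    qed
    then show False using no_slice by blast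
  qed
qed

section \<open>Consequences of being a best approximation\<close>

definition best2 where
  "best2 A B \<longleftrightarrow> B \<in> rank_le_2 \<and> (\<forall>C\<in>rank_le_2. norm (A - B) \<le> norm (A - C))"

lemma best2_transpose: "best2 A B \<Longrightarrow> best2 (transpose A) (transpose B)"
  by (metis best2_def norm_transpose_diff transpose_rank_le_2 transpose_transpose)

lemma best2_swap13: "best2 A B \<Longrightarrow> best2 (swap13 A) (swap13 B)"
  by (metis best2_def norm_swap13_diff swap13_rank_le_2 swap13_swap13)

text \<open>The shared direction turns the approximation into a single \<open>tprod e N\<close>, and
  the slice at \<open>e\<close> is at least as close.\<close>

lemma best2_opt_slice:
  assumes "best2 A (outer (s *\<^sub>R e) b1 c1 + outer (t *\<^sub>R e) b2 c2)" "norm e = 1"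
  shows "opt_slice A e"
proof -
  have B: "outer (s *\<^sub>R e) b1 c1 + outer (t *\<^sub>R e) b2 c2 = tprod e (s *\<^sub>R tprod b1 c1 + t *\<^sub>R tprod b2 c2)"
    by (simp add: outer_eq_tprod tprod_linear)
  have "(norm A)\<^sup>2 - (norm (contr A e))\<^sup>2 \<le> (norm (A - C))\<^sup>2" if "C \<in> rank_le_2" for C
  proof -
    have "norm (A - tprod e (s *\<^sub>R tprod b1 c1 + t *\<^sub>R tprod b2 c2)) \<le> norm (A - C)"
      using that assms(1) unfolding B best2_def by blast
    then show ?thesis using norm_diff_tprod_ge[OF assms(2), of A] by (meson norm_ge_zero order_trans power_mono)
  qed
  then show ?thesis by (simp add: opt_slice_def assms(2))
qed

text \<open>Varying one factor of a summand stays within two terms, so the first-order condition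
  applies. Exchanging the summands gives the same for the second.\<close>

lemma best2_stationary:
  assumes "best2 A (outer a1 b1 c1 + outer a2 b2 c2)"
  defines "E \<equiv> A - (outer a1 b1 c1 + outer a2 b2 c2)"
  shows "E \<bullet> outer x b1 c1 = 0" "E \<bullet> outer a1 y c1 = 0" "E \<bullet> outer a1 b1 z = 0"
proof -
  have *: "E \<bullet> D = 0"
    if "\<And>t. outer a1 b1 c1 + outer a2 b2 c2 + t *\<^sub>R D \<in> rank_le_2" for D
  proof (rule inner_eq_0_if_norm_minimal)
    fix t
    show "norm E \<le> norm (E - t *\<^sub>R D)"
      using that[of t] assms(1) unfolding best2_def E_def diff_diff_eq by blast
  qed
  have "outer a1 b1 c1 + outer a2 b2 c2 + t *\<^sub>R outer x b1 c1 = outer (a1 + t *\<^sub>R x) b1 c1 + outer a2 b2 c2"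
    "outer a1 b1 c1 + outer a2 b2 c2 + t *\<^sub>R outer a1 y c1 = outer a1 (b1 + t *\<^sub>R y) c1 + outer a2 b2 c2"
    "outer a1 b1 c1 + outer a2 b2 c2 + t *\<^sub>R outer a1 b1 z = outer a1 b1 (c1 + t *\<^sub>R z) + outer a2 b2 c2"
    for t by (simp_all add: outer_eq_tprod tprod_linear)
  then have "outer a1 b1 c1 + outer a2 b2 c2 + t *\<^sub>R outer x b1 c1 \<in> rank_le_2"
    "outer a1 b1 c1 + outer a2 b2 c2 + t *\<^sub>R outer a1 y c1 \<in> rank_le_2"
    "outer a1 b1 c1 + outer a2 b2 c2 + t *\<^sub>R outer a1 b1 z \<in> rank_le_2" for t
    by (simp_all only: rank_le_2I)
  then show "E \<bullet> outer x b1 c1 = 0" "E \<bullet> outer a1 y c1 = 0" "E \<bullet> outer a1 b1 z = 0"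
    by (simp_all only: *)
qed

text \<open>The residual is orthogonal to the whole block and to \<open>B\<close>, so Pythagoras
  expresses the minimal distance through the block entries of \<open>A\<close>.\<close>

lemma best2_opt_core:
  assumes best: "best2 A (outer a1 b1 c1 + outer a2 b2 c2)"
    and u: "orthonormal2 u1 u2" "\<alpha> \<noteq> 0" "\<beta> \<noteq> 0" "a1 = \<alpha> *\<^sub>R u2" "a2 = \<beta> *\<^sub>R u1 + \<gamma> *\<^sub>R u2"
    and v: "orthonormal2 v1 v2" "\<alpha>' \<noteq> 0" "\<beta>' \<noteq> 0" "b2 = \<alpha>' *\<^sub>R v2" "b1 = \<beta>' *\<^sub>R v1 + \<gamma>' *\<^sub>R v2"
    and w: "orthonormal2 w1 w2" "\<delta> \<noteq> 0" "\<epsilon> \<noteq> 0" "c1 = \<delta> *\<^sub>R w2" "c2 = \<epsilon> *\<^sub>R w1 + \<zeta> *\<^sub>R w2"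
  shows "opt_core A u1 u2 v1 v2 w1 w2"
proof -
  define B where "B = outer a1 b1 c1 + outer a2 b2 c2"
  define E where "E = A - B"
  have best': "best2 A (outer a2 b2 c2 + outer a1 b1 c1)" using best by (simp add: add.commute)
  have 1: "E \<bullet> outer x b1 c1 = 0" "E \<bullet> outer a1 y c1 = 0" "E \<bullet> outer a1 b1 z = 0" for x y z
    using best2_stationary[OF best] by (auto simp: E_def B_def)
  have 2: "E \<bullet> outer x b2 c2 = 0" "E \<bullet> outer a2 y c2 = 0" "E \<bullet> outer a2 b2 z = 0" for x y z
    using best2_stationary[OF best'] by (auto simp: E_def B_def add.commute)
  have tou: "E \<bullet> outer u1 y z = 0 \<and> E \<bullet> outer u2 y z = 0"
    if "E \<bullet> outer a1 y z = 0" "E \<bullet> outer a2 y z = 0" for y z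
    using that u by (simp add: outer_eq_tprod tprod_linear inner_add_right)
  have tov: "E \<bullet> outer x v1 z = 0 \<and> E \<bullet> outer x v2 z = 0"
    if "E \<bullet> outer x b1 z = 0" "E \<bullet> outer x b2 z = 0" for x z
    using that v by (simp add: outer_eq_tprod tprod_linear inner_add_right)
  have tow: "E \<bullet> outer x y w1 = 0 \<and> E \<bullet> outer x y w2 = 0"
    if "E \<bullet> outer x y c1 = 0" "E \<bullet> outer x y c2 = 0" for x y
    using that w by (simp add: outer_eq_tprod tprod_linear inner_add_right)
  \<comment> \<open>Two of the three indices of
    \<open>a\<^sub>i \<otimes> b\<^sub>j \<otimes> c\<^sub>k\<close> coincide, so it arises from a
    summand by changing one factor. Triangular basis changes then pass to the orthonormal vectors,
    one mode at a time.\<close>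
  have "E \<bullet> outer x y c1 = 0 \<and> E \<bullet> outer x y c2 = 0" if "x \<in> {a1, a2}" "y \<in> {b1, b2}" for x y
    using that 1 2 by auto
  then have "E \<bullet> outer x y w1 = 0 \<and> E \<bullet> outer x y w2 = 0" if "x \<in> {a1, a2}" "y \<in> {b1, b2}" for x y
    using that tow by blast
  then have "E \<bullet> outer x y z = 0" if "x \<in> {a1, a2}" "y \<in> {v1, v2}" "z \<in> {w1, w2}" for x y z
    using that tov by blast
  then have "E \<bullet> outer x y z = 0" if "x \<in> {u1, u2}" "y \<in> {v1, v2}" "z \<in> {w1, w2}" for x y z
    using that tou by blast
  then have AB: "A \<bullet> outer x y z = B \<bullet> outer x y z"
    if "x \<in> {u1, u2}" "y \<in> {v1, v2}" "z \<in> {w1, w2}" for x y z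
    using that by (simp add: E_def inner_diff_left)
  note on = u(1)[unfolded orthonormal2_def] v(1)[unfolded orthonormal2_def] w(1)[unfolded orthonormal2_def]
  have on': "u2 \<bullet> u1 = 0" "v2 \<bullet> v1 = 0" "w2 \<bullet> w1 = 0" using on by (simp_all add: inner_commute)
  \<comment> \<open>\<open>a1\<close> has no \<open>u1\<close> component and \<open>b2\<close> no
    \<open>v1\<close> component, so both summands vanish on \<open>u1, v1\<close>.\<close>
  have coords: "A \<bullet> outer u1 v1 w1 = 0" "A \<bullet> outer u1 v1 w2 = 0"
    "A \<bullet> outer u1 v2 w1 = \<beta> * \<alpha>' * \<epsilon>" "A \<bullet> outer u1 v2 w2 = \<beta> * \<alpha>' * \<zeta>"
    "A \<bullet> outer u2 v1 w1 = 0" "A \<bullet> outer u2 v1 w2 = \<alpha> * \<beta>' * \<delta>"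
    "A \<bullet> outer u2 v2 w1 = \<gamma> * \<alpha>' * \<epsilon>" "A \<bullet> outer u2 v2 w2 = \<alpha> * \<gamma>' * \<delta> + \<gamma> * \<alpha>' * \<zeta>"
    by (simp_all add: AB B_def inner_add_left inner_outer_outer u(4,5) v(4,5) w(4,5) on on')
  have "E \<bullet> B = 0" using 1 2 by (simp add: B_def inner_add_right)
  moreover have "A = E + B" by (simp add: E_def)
  ultimately have "(norm A)\<^sup>2 = (norm E)\<^sup>2 + (norm B)\<^sup>2"
    by (simp add: power2_norm_eq_inner inner_add_left inner_add_right inner_commute)
  moreover have "(norm B)\<^sup>2 = (\<beta> * \<alpha>' * \<epsilon>)\<^sup>2 + (\<beta> * \<alpha>' * \<zeta>)\<^sup>2 + (\<alpha> * \<beta>' * \<delta>)\<^sup>2 +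
      (\<gamma> * \<alpha>' * \<epsilon>)\<^sup>2 + (\<alpha> * \<gamma>' * \<delta> + \<gamma> * \<alpha>' * \<zeta>)\<^sup>2"
    unfolding power2_norm_eq_inner B_def
    by (simp add: inner_add_left inner_add_right inner_outer_outer u(4,5) v(4,5) w(4,5) on on')
       (simp add: power2_eq_square algebra_simps)
  moreover have "(norm E)\<^sup>2 \<le> (norm (A - C))\<^sup>2" if "C \<in> rank_le_2" for C
    using best that by (simp add: best2_def E_def B_def power_mono)
  ultimately show ?thesis
    by (simp add: opt_core_def u(1) v(1) w(1) coords add.assoc)
qed

lemma best2_cases:
  assumes "best2 A B"
  obtains u where "opt_slice A u" | v where "opt_slice (transpose A) v"
  | w where "opt_slice (swap13 A) w"
  | u1 u2 v1 v2 w1 w2 where "opt_core A u1 u2 v1 v2 w1 w2"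
proof -
  from assms obtain a1 b1 c1 a2 b2 c2 where B: "B = outer a1 b1 c1 + outer a2 b2 c2"
    by (auto simp: best2_def rank_le_2_def)
  have B1: "best2 A (outer a1 b1 c1 + outer a2 b2 c2)"
    using assms B by simp
  have B2: "best2 (transpose A) (outer b2 a2 c2 + outer b1 a1 c1)"
    using best2_transpose[OF assms] by (simp add: B transpose_add transpose_outer add.commute)
  have B3: "best2 (swap13 A) (outer c1 b1 a1 + outer c2 b2 a2)"
    using best2_swap13[OF assms] by (simp add: B swap13_add swap13_outer)
  show ?thesis
  proof (cases rule: gram_schmidt2[of a1 a2])
    case dependent
    then show ?thesis using that(1) best2_opt_slice B1 by metis
  next
    case u: (independent u1 u2 \<alpha> \<beta> \<gamma>)
    show ?thesis
    \<comment> \<open>The reversed order makes \<open>v1\<close> orthogonal to \<open>b2\<close>,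
      whereas \<open>u1\<close> is orthogonal to \<open>a1\<close>.\<close>
    proof (cases rule: gram_schmidt2[of b2 b1])
      case dependent
      then show ?thesis using that(2) best2_opt_slice B2 by metis
    next
      case v: (independent v1 v2 \<alpha>' \<beta>' \<gamma>')
      show ?thesis
      proof (cases rule: gram_schmidt2[of c1 c2])
        case dependent
        then show ?thesis using that(3) best2_opt_slice B3 by metis
      next
        case w: (independent w1 w2 \<delta> \<epsilon> \<zeta>)
        show ?thesis using that(4) best2_opt_core[OF B1 u v w] by blast
      qed
    qed
  qed
qed

section \<open>Closedness and measurability\<close>

lemma continuous_on_tprod [continuous_intros]:
  assumes "continuous_on S f" "continuous_on S g"
  shows "continuous_on S (\<lambda>x. tprod (f x) (g x))"
  unfolding tprod_def by (intro continuous_intros assms)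

lemma continuous_on_contr [continuous_intros]:
  assumes "continuous_on S f" "continuous_on S g"
  shows "continuous_on S (\<lambda>x. contr (f x) (g x))"
  unfolding contr_def by (intro continuous_intros assms)

lemma continuous_on_outer [continuous_intros]:
  assumes "continuous_on S f" "continuous_on S g" "continuous_on S h"
  shows "continuous_on S (\<lambda>x. outer (f x) (g x) (h x))"
  unfolding outer_eq_tprod by (intro continuous_intros assms)

lemma continuous_on_transpose [continuous_intros]:
  assumes "continuous_on S f"
  shows "continuous_on S (\<lambda>x. transpose (f x))"
  unfolding transpose_def by (intro continuous_intros assms)

lemma continuous_on_swap13 [continuous_intros]:
  assumes "continuous_on S f"
  shows "continuous_on S (\<lambda>x. swap13 (f x))"
  unfolding swap13_def by (intro continuous_intros assms)

text \<open>Each \<open>C\<close> imposes a nonstrict inequality, closed in \<open>(u, A)\<close>;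
  projecting along the compact unit sphere preserves closedness.\<close>

lemma closed_opt_slice: "closed {A :: real ^ 'd3 ^ 'd2 ^ 'd1. \<exists>u. opt_slice A u}"
proof -
  have "closed {y. \<exists>x. x \<in> sphere 0 1 \<and> (x, y) \<in> {(u, A :: real ^ 'd3 ^ 'd2 ^ 'd1).
      \<forall>C\<in>rank_le_2. (norm A)\<^sup>2 - (norm (contr A u))\<^sup>2 \<le> (norm (A - C))\<^sup>2}}"
    unfolding case_prod_unfold Ball_def
    by (intro closed_compact_projection compact_sphere closed_Collect_all closed_Collect_imp
        open_Collect_const closed_Collect_le continuous_intros)
  moreover have "{y. \<exists>x. x \<in> sphere 0 1 \<and> (x, y) \<in> {(u, A :: real ^ 'd3 ^ 'd2 ^ 'd1).
      \<forall>C\<in>rank_le_2. (norm A)\<^sup>2 - (norm (contr A u))\<^sup>2 \<le> (norm (A - C))\<^sup>2}} = {A. \<exists>u. opt_slice A u}"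
    by (simp add: opt_slice_def)
  ultimately show ?thesis by simp
qed

lemma closed_opt_core:
  "closed {A :: real ^ 'd3 ^ 'd2 ^ 'd1. \<exists>u1 u2 v1 v2 w1 w2. opt_core A u1 u2 v1 v2 w1 w2}"
proof -
  define T where "T = {((u1, u2, v1, v2, w1, w2), A :: real ^ 'd3 ^ 'd2 ^ 'd1). opt_core A u1 u2 v1 v2 w1 w2}"
  \<comment> \<open>Orthonormality confines the six vectors to this compact product.\<close>
  define S where "S = sphere (0 :: real ^ 'd1) 1 \<times> sphere (0 :: real ^ 'd1) 1 \<times>
    sphere (0 :: real ^ 'd2) 1 \<times> sphere (0 :: real ^ 'd2) 1 \<times>
    sphere (0 :: real ^ 'd3) 1 \<times> sphere (0 :: real ^ 'd3) 1"
  have "compact S" unfolding S_def by (intro compact_Times compact_sphere)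
  moreover have "closed T"
    unfolding T_def case_prod_unfold opt_core_def orthonormal2_def Ball_def list.map sum_list_simps
      prod.sel
    by (intro closed_Collect_conj closed_Collect_all closed_Collect_imp
        open_Collect_const closed_Collect_le closed_Collect_eq continuous_intros)
  ultimately have "closed {y. \<exists>x. x \<in> S \<and> (x, y) \<in> T}"
    by (rule closed_compact_projection)
  moreover have "{y. \<exists>x. x \<in> S \<and> (x, y) \<in> T} =
      {A. \<exists>u1 u2 v1 v2 w1 w2. opt_core A u1 u2 v1 v2 w1 w2}"
  proof -
    have "(u1, u2, v1, v2, w1, w2) \<in> S" if "opt_core A u1 u2 v1 v2 w1 w2"
      for A :: "real ^ 'd3 ^ 'd2 ^ 'd1" and u1 u2 v1 v2 w1 w2
      using that by (simp add: S_def opt_core_def orthonormal2_def norm_eq_1)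
    then show ?thesis by (auto simp: T_def) blast+
  qed
  ultimately show ?thesis by simp
qed

text \<open>
  Measurability matters: \<^const>\<open>emeasure\<close> is 0 on non-measurable sets.
\<close>

lemma sets_lebesgue_best2: "{A :: real ^ 'd3 ^ 'd2 ^ 'd1. \<exists>B. best2 A B} \<in> sets lebesgue"
proof -
  define f where "f = (\<lambda>(a1, b1, c1, a2, b2, c2).
    outer a1 b1 c1 + outer a2 b2 c2 :: real ^ 'd3 ^ 'd2 ^ 'd1)"
  define T where "T = {(x, A). \<forall>C\<in>rank_le_2. norm (A - f x) \<le> norm (A - C)}"
  have f: "range f = rank_le_2"
    unfolding f_def rank_le_2_def by (auto simp: image_iff) blast+
  have "closed T"
    unfolding T_def f_def case_prod_unfold Ball_def
    by (intro closed_Collect_all closed_Collect_imp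
        open_Collect_const closed_Collect_le closed_Collect_eq continuous_intros)
  \<comment> \<open>The factors of a best approximation range over a noncompact space; exhausting it
    by balls yields a countable union of closed sets.\<close>
  then have "closed {y. \<exists>x. x \<in> cball 0 (real n) \<and> (x, y) \<in> T}" for n
    by (intro closed_compact_projection compact_cball)
  then have "{y. \<exists>x. x \<in> cball 0 (real n) \<and> (x, y) \<in> T} \<in> sets lebesgue" for n
    by (simp add: borel_closed sets_completionI_sets)
  then have "(\<Union>n. {y. \<exists>x. x \<in> cball 0 (real n) \<and> (x, y) \<in> T}) \<in> sets lebesgue"
    by blast
  moreover have "(\<Union>n. {y. \<exists>x. x \<in> cball 0 (real n) \<and> (x, y) \<in> T}) = {A. \<exists>B. best2 A B}"
  proof -
    have "\<exists>n. x \<in> cball 0 (real n)" for x :: "(real ^ 'd1) \<times> (real ^ 'd2) \<times> (real ^ 'd3) \<times>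
        (real ^ 'd1) \<times> (real ^ 'd2) \<times> (real ^ 'd3)"
      by (simp add: real_arch_simple)
    then have "(\<Union>n. {y. \<exists>x. x \<in> cball 0 (real n) \<and> (x, y) \<in> T}) = {A. \<exists>x. (x, A) \<in> T}"
      by blast
    also have "\<dots> = {A. \<exists>B\<in>range f. \<forall>C\<in>rank_le_2. norm (A - B) \<le> norm (A - C)}"
      by (simp add: T_def)
    finally show ?thesis by (simp add: f best2_def Bex_def)
  qed
  ultimately show ?thesis by simp
qed

section \<open>Outer rank and attained infima in terms of two-term sums\<close>

text \<open>Expansion in the standard basis. It supplies the witness that \<open>LEAST\<close> in
  \<open>outer_rank\<close> requires.\<close>

lemma ex_outer_sum:
  "\<exists>(r :: nat) x y z. A = (\<Sum>l<r. outer (x l) (y l) (z l))" for A :: "real ^ 'd3 ^ 'd2 ^ 'd1"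
proof -
  define g :: "'d1 \<times> 'd2 \<times> 'd3 \<Rightarrow> _" where
    "g = (\<lambda>(i, j, k). outer (A $ i $ j $ k *\<^sub>R axis i 1) (axis j 1) (axis k 1))"
  have "A $ i $ j $ k = (\<Sum>p\<in>UNIV. g p) $ i $ j $ k" for i j k
  proof -
    have "(\<Sum>p\<in>UNIV. g p) $ i $ j $ k = (\<Sum>p\<in>UNIV. if p = (i, j, k) then A $ i $ j $ k else 0)"
      unfolding sum_component
      by (intro sum.cong) (auto simp: g_def outer_def axis_def split: if_splits)
    then show ?thesis by simp
  qed
  then have A: "A = (\<Sum>p\<in>UNIV. g p)" by (simp add: vec_eq_iff)
  obtain h where h: "bij_betw h {..<card (UNIV :: ('d1 \<times> 'd2 \<times> 'd3) set)} (UNIV :: ('d1 \<times> 'd2 \<times> 'd3) set)"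
    using ex_bij_betw_nat_finite[of "UNIV :: ('d1 \<times> 'd2 \<times> 'd3) set"] by (auto simp: atLeast0LessThan)
  have "A = (\<Sum>l<card (UNIV :: ('d1 \<times> 'd2 \<times> 'd3) set). g (h l))"
    unfolding A by (rule sum.reindex_bij_betw[OF h, symmetric])
  moreover define x y z where "x l = (case h l of (i, j, k) \<Rightarrow> A $ i $ j $ k *\<^sub>R (axis i 1 :: real ^ 'd1))"
    and "y l = (axis (fst (snd (h l))) 1 :: real ^ 'd2)"
    and "z l = (axis (snd (snd (h l))) 1 :: real ^ 'd3)" for l
  ultimately have "A = (\<Sum>l<card (UNIV :: ('d1 \<times> 'd2 \<times> 'd3) set). outer (x l) (y l) (z l))"
    by (simp add: g_def case_prod_unfold)
  then show ?thesis by - (intro exI, assumption)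
qed

lemma outer_rank_le_2_iff: "outer_rank B \<le> 2 \<longleftrightarrow> B \<in> rank_le_2"
proof
  assume le: "outer_rank B \<le> 2"
  have "\<exists>x y z. B = (\<Sum>l<outer_rank B. outer (x l) (y l) (z l))"
    unfolding outer_rank_def using ex_outer_sum[of B] by (rule LeastI_ex)
  then obtain x y z where B: "B = (\<Sum>l<outer_rank B. outer (x l) (y l) (z l))" by blast
  \<comment> \<open>Missing summands are filled with zero products.\<close>
  have o0: "outer 0 y z = 0" for y :: "real ^ 'b" and z :: "real ^ 'a"
    by (simp add: outer_eq_tprod tprod_linear)
  consider "outer_rank B = 0" | "outer_rank B = 1" | "outer_rank B = 2" using le by linarith
  then show "B \<in> rank_le_2"
  proof cases
    case 1
    then have "B = outer 0 0 0 + outer 0 0 0" using B by (simp add: o0)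
    then show ?thesis using rank_le_2I by metis
  next
    case 2
    then have "B = outer (x 0) (y 0) (z 0) + outer 0 0 0" using B by (simp add: o0)
    then show ?thesis using rank_le_2I by metis
  next
    case 3
    then have "B = outer (x 0) (y 0) (z 0) + outer (x 1) (y 1) (z 1)"
      using B by (simp add: numeral_2_eq_2)
    then show ?thesis using rank_le_2I by metis
  qed
next
  assume "B \<in> rank_le_2"
  then obtain a1 b1 c1 a2 b2 c2 where "B = outer a1 b1 c1 + outer a2 b2 c2"
    by (auto simp: rank_le_2_def)
  moreover define x y z where "x l = (if l = 0 then a1 else a2)"
    and "y l = (if l = 0 then b1 else b2)" and "z l = (if l = 0 then c1 else c2)" for l :: nat
  ultimately have "B = (\<Sum>l<2::nat. outer (x l) (y l) (z l))"
    by (simp add: numeral_2_eq_2)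
  then have "\<exists>x y z. B = (\<Sum>l<2::nat. outer (x l) (y l) (z l))" by blast
  then show "outer_rank B \<le> 2" unfolding outer_rank_def by (rule Least_le)
qed

text \<open>Distances are bounded below by 0, so the real \<open>INF\<close> is a genuine lower
  bound, and attaining it means being a minimum.\<close>

lemma has_best_rank_approx_2_iff: "has_best_rank_approx 2 A \<longleftrightarrow> (\<exists>B. best2 A B)"
proof -
  have "(norm (A - B) = (INF C\<in>rank_le_2. norm (A - C))) \<longleftrightarrow> (\<forall>C\<in>rank_le_2. norm (A - B) \<le> norm (A - C))"
    if "B \<in> rank_le_2" for B
  proof
    assume "norm (A - B) = (INF C\<in>rank_le_2. norm (A - C))"
    moreover have "bdd_below ((\<lambda>C. norm (A - C)) ` rank_le_2)" by (rule bdd_belowI2[of _ 0]) simp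
    ultimately show "\<forall>C\<in>rank_le_2. norm (A - B) \<le> norm (A - C)" by (metis cINF_lower)
  next
    assume "\<forall>C\<in>rank_le_2. norm (A - B) \<le> norm (A - C)"
    then show "norm (A - B) = (INF C\<in>rank_le_2. norm (A - C))"
      using that by (intro cInf_eq_minimum[symmetric]) auto
  qed
  then show ?thesis
    by (auto simp: has_best_rank_approx_def best2_def frobenius_norm_eq_norm outer_rank_le_2_iff)
qed

section \<open>Matrix action and padding\<close>

lemma sum_product3:
  "(\<Sum>i\<in>I. a i) * (\<Sum>j\<in>J. b j) * (\<Sum>k\<in>K. c k) = (\<Sum>i\<in>I. \<Sum>j\<in>J. \<Sum>k\<in>K. a i * b j * c k)"
  for a :: "'a \<Rightarrow> real"
proof -
  have "(\<Sum>i\<in>I. a i) * ((\<Sum>j\<in>J. b j) * (\<Sum>k\<in>K. c k)) =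
      (\<Sum>i\<in>I. \<Sum>j\<in>J. \<Sum>k\<in>K. a i * (b j * c k))"
    by (simp only: sum_product) (simp only: sum_distrib_left)
  then show ?thesis by (simp only: mult.assoc)
qed

lemma multilinear_mult_outer:
  "multilinear_mult L M N (outer x y z) = outer (L *v x) (M *v y) (N *v z)"
  unfolding multilinear_mult_def outer_def matrix_vector_mult_def vec_eq_iff vec_lambda_beta
    sum_product3
  by (simp add: mult_ac)

lemma multilinear_mult_add:
  "multilinear_mult L M N (A + B) = multilinear_mult L M N A + multilinear_mult L M N B"
  and multilinear_mult_diff:
  "multilinear_mult L M N (A - B) = multilinear_mult L M N A - multilinear_mult L M N B"
  by (simp_all add: multilinear_mult_def vec_eq_iff algebra_simps sum.distrib sum_subtractf)

lemma pad_outer_axis: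
  assumes "inj \<iota>1" "inj \<iota>2" "inj \<iota>3"
  shows "pad \<iota>1 \<iota>2 \<iota>3 (outer (axis a 1) (axis b 1) (axis c 1)) =
    outer (axis (\<iota>1 a) 1) (axis (\<iota>2 b) 1) (axis (\<iota>3 c) 1)"
  using assms by (auto simp: pad_def outer_def axis_def vec_eq_iff inj_eq)

lemma pad_add: "pad \<iota>1 \<iota>2 \<iota>3 (A + B) = pad \<iota>1 \<iota>2 \<iota>3 A + pad \<iota>1 \<iota>2 \<iota>3 B"
  and pad_diff: "pad \<iota>1 \<iota>2 \<iota>3 (A - B) = pad \<iota>1 \<iota>2 \<iota>3 A - pad \<iota>1 \<iota>2 \<iota>3 B"
  by (simp_all add: pad_def vec_eq_iff)

lemma indep2_matrix_axis:
  fixes L :: "real ^ 'n ^ 'n"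
  assumes "invertible L" "i \<noteq> j"
  shows "indep2 (L *v axis i 1) (L *v axis j 1)"
  unfolding indep2_def
proof (intro allI impI)
  fix s t
  assume "s *\<^sub>R (L *v axis i 1) + t *\<^sub>R (L *v axis j 1) = 0"
  then have "L *v (s *\<^sub>R axis i 1 + t *\<^sub>R axis j 1) = L *v 0"
    by (simp add: matrix_vector_right_distrib matrix_vector_mult_scaleR)
  then have "s *\<^sub>R axis i 1 + t *\<^sub>R axis j (1 :: real) = 0"
    using inj_matrix_vector_mult[OF assms(1)] by (simp only: inj_eq)
  then have "(s *\<^sub>R axis i 1 + t *\<^sub>R axis j (1 :: real)) $ i = 0"
    "(s *\<^sub>R axis i 1 + t *\<^sub>R axis j (1 :: real)) $ j = 0" by simp_all
  then show "s = 0 \<and> t = 0" using assms(2) by (simp add: axis_def)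
qed

text \<open>The vectors are the columns of \<open>L\<close>, \<open>M\<close>, \<open>N\<close> at
  the images of 1 and 2; injectivity of the index maps makes these columns distinct, hence
  independent.\<close>

lemma type_G3_g3_form:
  assumes "type_G3 \<iota>1 \<iota>2 \<iota>3 A" "inj \<iota>1" "inj \<iota>2" "inj \<iota>3"
  obtains l1 l2 m1 m2 n1 n2 where "A = g3_form l1 l2 m1 m2 n1 n2"
    "indep2 l1 l2" "indep2 m1 m2" "indep2 n1 n2"
proof -
  from assms(1) obtain L M N where inv: "invertible L" "invertible M" "invertible N"
    and A: "A = multilinear_mult L M N (pad \<iota>1 \<iota>2 \<iota>3 G3)"
    by (auto simp: type_G3_def)
  have "A = g3_form (L *v axis (\<iota>1 1) 1) (L *v axis (\<iota>1 2) 1) (M *v axis (\<iota>2 1) 1)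
      (M *v axis (\<iota>2 2) 1) (N *v axis (\<iota>3 1) 1) (N *v axis (\<iota>3 2) 1)"
    by (simp add: A G3_def Let_def g3_form_def pad_add pad_diff pad_outer_axis[OF assms(2-4)]
        multilinear_mult_add multilinear_mult_diff multilinear_mult_outer)
  moreover have "\<iota>1 1 \<noteq> \<iota>1 2" "\<iota>2 1 \<noteq> \<iota>2 2" "\<iota>3 1 \<noteq> \<iota>3 2"
    using assms(2-4) by (simp_all add: inj_eq)
  ultimately show thesis using that indep2_matrix_axis inv by metis
qed

theorem theorem8p4:
  fixes \<iota>1 :: "2 \<Rightarrow> 'd1::finite" and \<iota>2 :: "2 \<Rightarrow> 'd2::finite" and \<iota>3 :: "2 \<Rightarrow> 'd3::finite"
  assumes "CARD('d1) \<ge> 2" and "CARD('d2) \<ge> 2" and "CARD('d3) \<ge> 2"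
    and "inj \<iota>1" and "inj \<iota>2" and "inj \<iota>3"
  shows "(\<exists>U. open U \<and> {A. type_G3 \<iota>1 \<iota>2 \<iota>3 A} \<subseteq> U \<and>
            U \<subseteq> {A :: real ^ 'd3 ^ 'd2 ^ 'd1. \<not> has_best_rank_approx 2 A}) \<and>
         {A :: real ^ 'd3 ^ 'd2 ^ 'd1. \<not> has_best_rank_approx 2 A} \<noteq> {} \<and>
         emeasure lebesgue {A :: real ^ 'd3 ^ 'd2 ^ 'd1. \<not> has_best_rank_approx 2 A} > 0"
proof -
  \<comment> \<open>Slice conditions in the second and third modes concern arrays of permuted shape,
    so they are pulled back along the mode permutations.\<close>
  define F where "F = {A :: real ^ 'd3 ^ 'd2 ^ 'd1. \<exists>u. opt_slice A u} \<union>
    transpose -` {A. \<exists>u. opt_slice A u} \<union> swap13 -` {A. \<exists>u. opt_slice A u} \<union>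
    {A. \<exists>u1 u2 v1 v2 w1 w2. opt_core A u1 u2 v1 v2 w1 w2}"
  let ?N = "{A :: real ^ 'd3 ^ 'd2 ^ 'd1. \<not> has_best_rank_approx 2 A}"
  have "closed F"
    unfolding F_def
    by (intro closed_Un closed_opt_slice closed_opt_core closed_vimage continuous_intros)
  then have "open (- F)" by (rule open_Compl)
  moreover have G3_sub: "{A. type_G3 \<iota>1 \<iota>2 \<iota>3 A} \<subseteq> - F"
  proof (intro subsetI)
    fix A assume "A \<in> {A. type_G3 \<iota>1 \<iota>2 \<iota>3 A}"
    then obtain l1 l2 m1 m2 n1 n2 where A: "A = g3_form l1 l2 m1 m2 n1 n2"
      and i: "indep2 l1 l2" "indep2 m1 m2" "indep2 n1 n2"
      using type_G3_g3_form assms(4-6) by (metis mem_Collect_eq)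
    show "A \<in> - F"
      unfolding F_def A
      using i indep2_minus[OF i(3)]
      by (simp add: transpose_g3_form swap13_g3_form not_opt_slice_g3_form not_opt_core_g3_form)
  qed
  moreover have sub: "- F \<subseteq> ?N"
    by (auto simp: F_def has_best_rank_approx_2_iff elim: best2_cases)
  moreover have nonempty: "- F \<noteq> {}"
  proof -
    have "type_G3 \<iota>1 \<iota>2 \<iota>3 (multilinear_mult (mat 1) (mat 1) (mat 1) (pad \<iota>1 \<iota>2 \<iota>3 G3))"
      unfolding type_G3_def 
      by (intro exI[of _ "mat 1"]) (simp add: invertible_def exI[of _ "mat 1"])
    then show ?thesis using G3_sub by blast
  qed
  \<comment> \<open>A measurable set of measure zero is negligible, and so would be its nonempty
    open subset \<open>- F\<close>.\<close>
  moreover have "emeasure lebesgue ?N > 0"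
  proof (rule ccontr)
    assume "\<not> ?thesis"
    moreover have "?N = UNIV - {A. \<exists>B. best2 A B}"
      by (auto simp: has_best_rank_approx_2_iff)
    then have "?N \<in> sets lebesgue"
      using sets.compl_sets[OF sets_lebesgue_best2] by simp
    ultimately have "negligible ?N" by (simp add: negligible_iff_null_sets null_sets_def)
    then have "negligible (- F)" using sub negligible_subset by blast
    then show False using open_not_negligible \<open>open (- F)\<close> nonempty by blast
  qed
  ultimately show ?thesis by blast
qed

end
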